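(* If $G$ is a connected simple graph that is $(2K_2,\text{claw})$-free and satisfies $\alpha(G) \geq 3$, then $G$ is split.
   Context: $2K_2$ is the graph consisting of two vertex-disjoint edges; a claw is $K_{1,3}$. A graph is $(H_1,H_2)$-free if it has no induced subgraph isomorphic to $H_1$ or $H_2$. $\alpha(G)$ is the maximum size of an independent set of $G$. A graph is split if its vertex set can be partitioned into a clique and an independent set. *)

theory Defs
  imports "Graph_Theory.Graph_Theory"
begin

text \<open>
  Finite simple graphs are the models of the locale \<^locale>\<open>graph\<close>: finite, loop-free digraphs
  without parallel arcs whose arc relation is symmetric. An undirected edge \<open>uv\<close> is the
  pair of arcs \<open>(u, v)\<close> and \<open>(v, u)\<close>, and \<open>u \<rightarrow>\<^bsub>G\<^esub> v\<close> is adjacency.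
\<close>

definition two_K2 :: "nat pair_pre_digraph" where
  "two_K2 = \<lparr>pverts = {0, 1, 2, 3}, parcs = {(0, 1), (1, 0), (2, 3), (3, 2)}\<rparr>"

definition claw :: "nat pair_pre_digraph" where
  "claw = \<lparr>pverts = {0, 1, 2, 3},
    parcs = {(0, 1), (1, 0), (0, 2), (2, 0), (0, 3), (3, 0)}\<rparr>"

lemma pair_graph_two_K2: "pair_graph two_K2"
proof
  show "symmetric (with_proj two_K2)"
    by (simp add: symmetric_def sym_def two_K2_def)
qed (auto simp: two_K2_def)

lemma complete_bipartite_claw: "K\<^bsub>1,3\<^esub> (with_proj claw)"
proof -
  have "pverts claw = {0} \<union> {1, 2, 3}"
    and "parcs claw = {0} \<times> {1, 2, 3} \<union> {1, 2, 3} \<times> {0}"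
    by (auto simp: claw_def)
  moreover have "finite (pverts claw)" "{0} \<inter> {1, 2, 3} = ({} :: nat set)"
    "card {0 :: nat} = 1" "card {1, 2, 3 :: nat} = 3"
    by (simp_all add: claw_def)
  ultimately show ?thesis
    unfolding complete_bipartite_digraph_pair_def by blast
qed

definition has_induced_copy ::
    "('a, 'b) pre_digraph \<Rightarrow> ('c, 'd) pre_digraph \<Rightarrow> bool" where
  "has_induced_copy G H \<longleftrightarrow> (\<exists>K. induced_subgraph K G \<and> digraph_iso K H)"

definition induced_free2 ::
    "('a, 'b) pre_digraph \<Rightarrow> ('c, 'd) pre_digraph \<Rightarrow> ('e, 'f) pre_digraph \<Rightarrow> bool" where
  "induced_free2 G H1 H2 \<longleftrightarrow> \<not> (has_induced_copy G H1 \<or> has_induced_copy G H2)"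

definition is_clique :: "('a, 'b) pre_digraph \<Rightarrow> 'a set \<Rightarrow> bool" where
  "is_clique G S \<longleftrightarrow> S \<subseteq> verts G \<and> (\<forall>u \<in> S. \<forall>v \<in> S. u \<noteq> v \<longrightarrow> u \<rightarrow>\<^bsub>G\<^esub> v)"

definition is_independent :: "('a, 'b) pre_digraph \<Rightarrow> 'a set \<Rightarrow> bool" where
  "is_independent G S \<longleftrightarrow> S \<subseteq> verts G \<and> (\<forall>u \<in> S. \<forall>v \<in> S. \<not> u \<rightarrow>\<^bsub>G\<^esub> v)"

definition independence_number :: "('a, 'b) pre_digraph \<Rightarrow> nat" (\<open>\<alpha>\<close>) where
  "independence_number G = Max (card ` {S. is_independent G S})"

lemma finite_independent_sets:
  assumes "finite (verts G)"
  shows "finite {S. is_independent G S}"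
  by (rule finite_subset[of _ "Pow (verts G)"]) (use assms in \<open>auto simp: is_independent_def\<close>)

text \<open>Either part of the partition may be empty.\<close>

definition split_graph :: "('a, 'b) pre_digraph \<Rightarrow> bool" where
  "split_graph G \<longleftrightarrow>
    (\<exists>K I. verts G = K \<union> I \<and> K \<inter> I = {} \<and> is_clique G K \<and> is_independent G I)"

end

theory Submission
  imports Defs
begin

text \<open>
  Among the independent sets of maximum size take one, \<open>I\<close>, with least degree sum; its complement
  is a clique. Otherwise let \<open>u, v \<notin> I\<close> be non-adjacent. By \<open>2K\<^sub>2\<close>-freeness their neighbourhoods in
  \<open>I\<close> are nested, so they share some \<open>a \<in> I\<close>, and by claw-freeness some \<open>w \<in> I\<close> is adjacent to
  neither. A neighbour \<open>x\<close> of \<open>w\<close> is then adjacent to \<open>a\<close> and to exactly one of \<open>u, v\<close>, say to \<open>q\<close>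
  and not to \<open>p\<close>. This forces \<open>a\<close> to be the only neighbour of \<open>p\<close> in \<open>I\<close> and all other neighbours
  of \<open>p\<close> to be adjacent to \<open>a\<close>, as is \<open>q\<close>; so \<open>p\<close> has smaller degree than \<open>a\<close>, and exchanging \<open>a\<close>
  for \<open>p\<close> in \<open>I\<close> contradicts the choice of \<open>I\<close>.
\<close>

lemma (in nomulti_digraph) has_induced_copyI:
  fixes H :: "'c pair_pre_digraph"
  assumes H: "parcs H \<subseteq> pverts H \<times> pverts H"
    and inj: "inj_on f (pverts H)"
    and sub: "f ` pverts H \<subseteq> verts G"
    and arcs: "\<And>u v. u \<in> pverts H \<Longrightarrow> v \<in> pverts H \<Longrightarrow> (u, v) \<in> parcs H \<longleftrightarrow> f u \<rightarrow>\<^bsub>G\<^esub> f v"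
  shows "has_induced_copy G (with_proj H)"
proof -
  define g where "g = the_inv_into (pverts H) f"
  define K where "K = G \<restriction> (f ` pverts H)"
  define h where "h = \<lparr>iso_verts = g, iso_arcs = (\<lambda>e. (g (tail G e), g (head G e))),
    iso_head = snd, iso_tail = fst\<rparr>"
  have gf [simp]: "g (f u) = u" if "u \<in> pverts H" for u
    using the_inv_into_f_f[OF inj that] by (simp add: g_def)
  have K: "induced_subgraph K G"
    unfolding K_def using sub by (rule induced_induce)
  have "pre_digraph.digraph_isomorphism K h"
    unfolding pre_digraph.digraph_isomorphism_def
  proof (intro conjI)
    show "wf_digraph K"
      using K by (auto simp: induced_subgraph_def subgraph_def)
    show "inj_on (iso_verts h) (verts K)"
      by (auto simp: h_def K_def inj_on_def)
    show "inj_on (iso_arcs h) (arcs K)"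
      by (rule inj_onI, rule no_multi_arcs) (auto simp: h_def K_def arc_to_ends_def)
    show "\<forall>e \<in> arcs K. iso_verts h (tail K e) = iso_tail h (iso_arcs h e) \<and>
        iso_verts h (head K e) = iso_head h (iso_arcs h e)"
      by (simp add: h_def K_def)
  qed
  moreover have "with_proj H = app_iso h K"
  proof (rule pre_digraph.equality)
    show "verts (with_proj H) = verts (app_iso h K)"
      by (auto simp: h_def K_def image_image)
    have "\<exists>e \<in> arcs K. (u, v) = iso_arcs h e" if uv: "(u, v) \<in> parcs H" for u v
    proof -
      have mem: "u \<in> pverts H" "v \<in> pverts H"
        using H uv by auto
      with arcs uv have "f u \<rightarrow>\<^bsub>G\<^esub> f v"
        by blast
      then obtain e where "e \<in> arcs G" "tail G e = f u" "head G e = f v"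
        by (auto simp: arcs_ends_conv)
      with mem show ?thesis
        by (intro bexI[of _ e]) (auto simp: h_def K_def)
    qed
    moreover have "iso_arcs h e \<in> parcs H" if "e \<in> arcs K" for e
    proof -
      obtain u v where uv: "u \<in> pverts H" "v \<in> pverts H"
          "e \<in> arcs G" "tail G e = f u" "head G e = f v"
        using \<open>e \<in> arcs K\<close> by (auto simp: K_def)
      then have "f u \<rightarrow>\<^bsub>G\<^esub> f v"
        by (metis in_arcs_imp_in_arcs_ends)
      with uv arcs show ?thesis
        by (auto simp: h_def)
    qed
    ultimately show "arcs (with_proj H) = arcs (app_iso h K)"
      by (auto simp: image_iff)
  qed (simp_all add: h_def)
  ultimately show ?thesis
    using K unfolding has_induced_copy_def digraph_iso_def by blast
qed

context graph
begin

lemma dominates_sym: "u \<rightarrow>\<^bsub>G\<^esub> v \<Longrightarrow> v \<rightarrow>\<^bsub>G\<^esub> u"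
  by (rule arcs_ends_symmetric[OF sym_arcs])

lemma dominates_commute: "u \<rightarrow>\<^bsub>G\<^esub> v \<longleftrightarrow> v \<rightarrow>\<^bsub>G\<^esub> u"
  by (rule iffI; erule dominates_sym)

lemma dominates_irrefl [simp]: "\<not> v \<rightarrow>\<^bsub>G\<^esub> v"
  using no_loops by (auto simp: arcs_ends_conv)

lemma dominates_in_verts: "u \<rightarrow>\<^bsub>G\<^esub> v \<Longrightarrow> u \<in> verts G \<and> v \<in> verts G"
  by (auto simp: arcs_ends_conv)

lemma finite_neighbours: "finite {y. v \<rightarrow>\<^bsub>G\<^esub> y}"
  by (rule finite_subset[OF _ finite_verts]) (use dominates_in_verts in auto)

lemma claw_freeD:
  assumes free: "\<not> has_induced_copy G (with_proj claw)"
    and "c \<rightarrow>\<^bsub>G\<^esub> x" "c \<rightarrow>\<^bsub>G\<^esub> y" "c \<rightarrow>\<^bsub>G\<^esub> z"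
    and "x \<noteq> y" "x \<noteq> z" "y \<noteq> z"
  shows "x \<rightarrow>\<^bsub>G\<^esub> y \<or> x \<rightarrow>\<^bsub>G\<^esub> z \<or> y \<rightarrow>\<^bsub>G\<^esub> z"
proof (rule ccontr)
  assume "\<not> ?thesis"
  then have nonadj: "\<not> x \<rightarrow>\<^bsub>G\<^esub> y" "\<not> y \<rightarrow>\<^bsub>G\<^esub> x" "\<not> x \<rightarrow>\<^bsub>G\<^esub> z" "\<not> z \<rightarrow>\<^bsub>G\<^esub> x"
      "\<not> y \<rightarrow>\<^bsub>G\<^esub> z" "\<not> z \<rightarrow>\<^bsub>G\<^esub> y"
    using dominates_sym by metis+
  have adj: "x \<rightarrow>\<^bsub>G\<^esub> c" "y \<rightarrow>\<^bsub>G\<^esub> c" "z \<rightarrow>\<^bsub>G\<^esub> c"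
    using assms(2-4)[THEN dominates_sym] .
  have "has_induced_copy G (with_proj claw)"
  proof (rule has_induced_copyI[where f = "(!) [c, x, y, z]"])
    have "c \<noteq> x" "c \<noteq> y" "c \<noteq> z"
      using assms(2-4) by auto
    then show "inj_on ((!) [c, x, y, z]) (pverts claw)"
      using assms(5-7) by (auto simp: claw_def inj_on_def)
    show "((!) [c, x, y, z]) ` pverts claw \<subseteq> verts G"
      using assms(2-4) dominates_in_verts by (auto simp: claw_def)
    show "(u, v) \<in> parcs claw \<longleftrightarrow> [c, x, y, z] ! u \<rightarrow>\<^bsub>G\<^esub> [c, x, y, z] ! v"
      if "u \<in> pverts claw" "v \<in> pverts claw" for u v
      using that by (simp add: claw_def, elim disjE) (simp_all add: assms(2-4) adj nonadj)
  qed (auto simp: claw_def)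
  with free show False ..
qed

lemma two_K2_freeD:
  assumes free: "\<not> has_induced_copy G (with_proj two_K2)"
    and "a \<rightarrow>\<^bsub>G\<^esub> b" "c \<rightarrow>\<^bsub>G\<^esub> d"
  shows "a \<rightarrow>\<^bsub>G\<^esub> c \<or> a \<rightarrow>\<^bsub>G\<^esub> d \<or> b \<rightarrow>\<^bsub>G\<^esub> c \<or> b \<rightarrow>\<^bsub>G\<^esub> d"
proof (rule ccontr)
  assume "\<not> ?thesis"
  then have nonadj: "\<not> a \<rightarrow>\<^bsub>G\<^esub> c" "\<not> a \<rightarrow>\<^bsub>G\<^esub> d" "\<not> b \<rightarrow>\<^bsub>G\<^esub> c" "\<not> b \<rightarrow>\<^bsub>G\<^esub> d"
      "\<not> c \<rightarrow>\<^bsub>G\<^esub> a" "\<not> d \<rightarrow>\<^bsub>G\<^esub> a" "\<not> c \<rightarrow>\<^bsub>G\<^esub> b" "\<not> d \<rightarrow>\<^bsub>G\<^esub> b"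
    using dominates_sym by metis+
  have adj: "b \<rightarrow>\<^bsub>G\<^esub> a" "d \<rightarrow>\<^bsub>G\<^esub> c"
    using assms(2,3)[THEN dominates_sym] .
  have "has_induced_copy G (with_proj two_K2)"
  proof (rule has_induced_copyI[where f = "(!) [a, b, c, d]"])
    have "a \<noteq> b" "c \<noteq> d" "a \<noteq> c" "a \<noteq> d" "b \<noteq> c" "b \<noteq> d"
      using assms(2,3) nonadj by auto
    then show "inj_on ((!) [a, b, c, d]) (pverts two_K2)"
      by (auto simp: two_K2_def inj_on_def)
    show "((!) [a, b, c, d]) ` pverts two_K2 \<subseteq> verts G"
      using assms(2,3) dominates_in_verts by (auto simp: two_K2_def)
    show "(u, v) \<in> parcs two_K2 \<longleftrightarrow> [a, b, c, d] ! u \<rightarrow>\<^bsub>G\<^esub> [a, b, c, d] ! v"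
      if "u \<in> pverts two_K2" "v \<in> pverts two_K2" for u v
      using that by (simp add: two_K2_def, elim disjE) (simp_all add: assms(2,3) adj nonadj)
  qed (auto simp: two_K2_def)
  with free show False ..
qed

lemma connected_neighbourE:
  assumes "Digraph_Component.connected G" "v \<in> verts G" "w \<in> verts G" "v \<noteq> w"
  obtains x where "w \<rightarrow>\<^bsub>G\<^esub> x"
proof -
  have "strongly_connected G"
    using assms(1) sym_arcs by (rule symmetric_connected_imp_strongly_connected[rotated])
  then have "w \<rightarrow>\<^sup>*\<^bsub>G\<^esub> v"
    using assms by (auto simp: strongly_connected_def)
  then show thesis
    using \<open>v \<noteq> w\<close> that by (cases rule: converse_reachable_cases) auto
qed

text \<open>The vertices \<open>p\<close> and \<open>a\<close> are the ones exchanged in the independent set \<open>I\<close>.\<close>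

lemma card_neighbours_less:
  assumes claw: "\<not> has_induced_copy G (with_proj claw)"
    and K2: "\<not> has_induced_copy G (with_proj two_K2)"
    and ind: "is_independent G I"
    and dom: "\<And>y. y \<in> verts G \<Longrightarrow> y \<notin> I \<Longrightarrow> \<exists>c \<in> I. y \<rightarrow>\<^bsub>G\<^esub> c"
    and I: "a \<in> I" "w \<in> I"
    and p: "p \<rightarrow>\<^bsub>G\<^esub> a" "\<And>b. b \<in> I \<Longrightarrow> p \<rightarrow>\<^bsub>G\<^esub> b \<Longrightarrow> b = a"
    and q: "q \<rightarrow>\<^bsub>G\<^esub> a" "\<not> q \<rightarrow>\<^bsub>G\<^esub> w" "\<not> p \<rightarrow>\<^bsub>G\<^esub> q" "p \<noteq> q"
    and x: "x \<rightarrow>\<^bsub>G\<^esub> w" "\<not> x \<rightarrow>\<^bsub>G\<^esub> p" "x \<rightarrow>\<^bsub>G\<^esub> q"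
      "\<And>b. b \<in> I \<Longrightarrow> x \<rightarrow>\<^bsub>G\<^esub> b \<Longrightarrow> b = a \<or> b = w"
  shows "card {y. p \<rightarrow>\<^bsub>G\<^esub> y} < card {y. a \<rightarrow>\<^bsub>G\<^esub> y}"
proof -
  have indD: "\<not> b \<rightarrow>\<^bsub>G\<^esub> c" if "b \<in> I" "c \<in> I" for b c
    using ind that by (auto simp: is_independent_def)
  have neq: "p \<noteq> w" "q \<noteq> w" "p \<notin> I" "p \<noteq> x" "x \<notin> I"
    using I p(1) q x indD by blast+
  have pw: "\<not> p \<rightarrow>\<^bsub>G\<^esub> w"
    using I p q by blast
  have sub: "a \<rightarrow>\<^bsub>G\<^esub> y" if py: "p \<rightarrow>\<^bsub>G\<^esub> y" and "y \<noteq> a" for y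
  proof (rule ccontr)
    assume ay: "\<not> a \<rightarrow>\<^bsub>G\<^esub> y"
    have yw: "\<not> y \<rightarrow>\<^bsub>G\<^esub> w"
    proof
      assume yw: "y \<rightarrow>\<^bsub>G\<^esub> w"
      then have "y \<rightarrow>\<^bsub>G\<^esub> q"
        using two_K2_freeD[OF K2 yw q(1)] ay q(2) indD[OF I] dominates_sym by metis
      then show False
        using claw_freeD[OF claw, of y p w q] yw py pw q neq dominates_sym by metis
    qed
    have yx: "y \<rightarrow>\<^bsub>G\<^esub> x"
      using two_K2_freeD[OF K2 py x(1)] x(2) pw yw dominates_sym by metis
    have "y \<notin> I"
      using p(2) py \<open>y \<noteq> a\<close> by blast
    then obtain c where c: "c \<in> I" "y \<rightarrow>\<^bsub>G\<^esub> c"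
      using dom dominates_in_verts[OF py] by blast
    then have "\<not> p \<rightarrow>\<^bsub>G\<^esub> c" "\<not> x \<rightarrow>\<^bsub>G\<^esub> c" "c \<noteq> p" "c \<noteq> x"
      using p(2) x(4) ay yw neq dominates_sym by metis+
    then show False
      using claw_freeD[OF claw yx _ c(2), of p] py x(2) neq dominates_sym by metis
  qed
  let ?N = "{y. a \<rightarrow>\<^bsub>G\<^esub> y}"
  have pq: "{p, q} \<subseteq> ?N"
    using p(1) q(1) by (simp add: dominates_commute)
  have "{y. p \<rightarrow>\<^bsub>G\<^esub> y} \<subseteq> insert a (?N - {p, q})"
    using sub q(3) by auto
  then have "card {y. p \<rightarrow>\<^bsub>G\<^esub> y} \<le> card (insert a (?N - {p, q}))"
    by (intro card_mono) (simp_all add: finite_neighbours)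
  also have "\<dots> \<le> Suc (card (?N - {p, q}))"
    by (rule card_insert_le_m1) simp_all
  also have "card (?N - {p, q}) = card ?N - 2"
    using pq \<open>p \<noteq> q\<close> by (simp add: card_Diff_subset)
  also have "Suc (card ?N - 2) < card ?N"
    using card_mono[OF finite_neighbours pq] \<open>p \<noteq> q\<close> by simp
  finally show ?thesis .
qed

end

theorem theorem3p3:
  fixes G :: "('a, 'b) pre_digraph"
  assumes "graph G"
    and "Digraph_Component.connected G"
    and "induced_free2 G (with_proj two_K2) (with_proj claw)"
    and "\<alpha> G \<ge> 3"
  shows "split_graph G"
proof -
  interpret graph G by fact
  have K2: "\<not> has_induced_copy G (with_proj two_K2)"
    and claw: "\<not> has_induced_copy G (with_proj claw)"
    using assms(3) by (auto simp: induced_free2_def)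
  let ?N = "\<lambda>v. {y. v \<rightarrow>\<^bsub>G\<^esub> y}"
  let ?m = "\<lambda>S. \<Sum>v \<in> S. card (?N v)"
  let ?max = "\<lambda>S. is_independent G S \<and> card S = \<alpha> G"
  have fin: "finite (card ` {S. is_independent G S})"
    using finite_independent_sets[OF finite_verts] by simp
  have le_alpha: "card S \<le> \<alpha> G" if "is_independent G S" for S
    unfolding independence_number_def using fin that by (intro Max_ge) auto
  have "is_independent G {}"
    by (simp add: is_independent_def)
  then have "\<alpha> G \<in> card ` {S. is_independent G S}"
    unfolding independence_number_def using fin by (intro Max_in) auto
  then obtain S where "?max S"
    by auto
  then obtain I where I: "is_independent G I" "card I = \<alpha> G"
    and least: "\<And>S. ?max S \<Longrightarrow> ?m I \<le> ?m S"
    using ex_has_least_nat[of ?max S ?m] by blast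
  have indD: "\<not> b \<rightarrow>\<^bsub>G\<^esub> c" if "b \<in> I" "c \<in> I" for b c
    using I that by (auto simp: is_independent_def)
  have I_sub: "I \<subseteq> verts G"
    using I by (simp add: is_independent_def)
  then have finI: "finite I"
    using finite_verts by (rule finite_subset)
  have dom: "\<exists>c \<in> I. y \<rightarrow>\<^bsub>G\<^esub> c" if "y \<in> verts G" "y \<notin> I" for y
  proof (rule ccontr)
    assume "\<not> ?thesis"
    then have "is_independent G (insert y I)"
      using I that by (auto simp: is_independent_def dominates_commute)
    then show False
      using le_alpha[of "insert y I"] I that finI by simp
  qed
  have exch: False
    if pq: "p \<notin> I" "p \<noteq> q" "\<not> p \<rightarrow>\<^bsub>G\<^esub> q" "\<not> q \<rightarrow>\<^bsub>G\<^esub> w"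
      and aw: "a \<in> I" "w \<in> I" "p \<rightarrow>\<^bsub>G\<^esub> a" "q \<rightarrow>\<^bsub>G\<^esub> a"
      and p: "\<And>b. b \<in> I \<Longrightarrow> p \<rightarrow>\<^bsub>G\<^esub> b \<Longrightarrow> b = a"
      and x: "x \<rightarrow>\<^bsub>G\<^esub> w" "\<not> x \<rightarrow>\<^bsub>G\<^esub> p" "x \<rightarrow>\<^bsub>G\<^esub> q"
        "\<And>b. b \<in> I \<Longrightarrow> x \<rightarrow>\<^bsub>G\<^esub> b \<Longrightarrow> b = a \<or> b = w" for p q a w x
  proof -
    let ?S = "insert p (I - {a})"
    have "is_independent G ?S"
      using I pq(1) p dominates_in_verts[OF aw(3)]
      by (auto simp: is_independent_def dominates_commute)
    moreover have "card ?S = card I"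
      using card_Suc_Diff1[OF finI aw(1)] finI pq(1) by simp
    ultimately have "?m I \<le> ?m ?S"
      using least I by simp
    moreover have "?m ?S = card (?N p) + ?m (I - {a})"
      using finI pq(1) by simp
    moreover have "?m I = card (?N a) + ?m (I - {a})"
      using finI aw(1) by (rule sum.remove)
    moreover have "card (?N p) < card (?N a)"
      by (rule card_neighbours_less[OF claw K2 I(1) _ aw(1-3) _ aw(4) pq(4,3,2) x(1-3)])
        (fact dom p x(4))+
    ultimately show False
      by simp
  qed
  have no_nested: False
    if u: "u \<in> verts G" "u \<notin> I" and v: "v \<in> verts G" "v \<notin> I"
      and uv: "u \<noteq> v" "\<not> u \<rightarrow>\<^bsub>G\<^esub> v"
      and nested: "\<And>b. b \<in> I \<Longrightarrow> u \<rightarrow>\<^bsub>G\<^esub> b \<Longrightarrow> v \<rightarrow>\<^bsub>G\<^esub> b" for u v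
  proof -
    obtain a where a: "a \<in> I" "u \<rightarrow>\<^bsub>G\<^esub> a" "v \<rightarrow>\<^bsub>G\<^esub> a"
      using dom[OF u] nested by blast
    have three: "b = c \<or> b = d \<or> c = d"
      if "z \<rightarrow>\<^bsub>G\<^esub> b" "z \<rightarrow>\<^bsub>G\<^esub> c" "z \<rightarrow>\<^bsub>G\<^esub> d" "b \<in> I" "c \<in> I" "d \<in> I" for z b c d
      using claw_freeD[OF claw that(1-3)] that(4-6) indD by metis
    obtain T where "T \<subseteq> I" "card T = 3"
      using obtain_subset_with_card_n[of 3 I] I assms(4) by auto
    then obtain b c d where bcd: "b \<in> I" "c \<in> I" "d \<in> I" "b \<noteq> c" "b \<noteq> d" "c \<noteq> d"
      by (auto simp: card_3_iff)
    then obtain w where w: "w \<in> I" "\<not> v \<rightarrow>\<^bsub>G\<^esub> w"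
      using three[of v b c d] by blast
    then have uw: "\<not> u \<rightarrow>\<^bsub>G\<^esub> w" and "w \<noteq> a" "w \<noteq> u" "w \<noteq> v"
      using nested a u v by blast+
    obtain x where wx: "w \<rightarrow>\<^bsub>G\<^esub> x"
      using connected_neighbourE[of u w] assms(2) u w I_sub \<open>w \<noteq> u\<close> by blast
    then have xw: "x \<rightarrow>\<^bsub>G\<^esub> w"
      using dominates_sym by metis
    have x_neq: "x \<noteq> u" "x \<noteq> v"
      using xw w uw by blast+
    have not_both: "\<not> (x \<rightarrow>\<^bsub>G\<^esub> u \<and> x \<rightarrow>\<^bsub>G\<^esub> v)"
      using claw_freeD[OF claw xw, of u v] \<open>w \<noteq> u\<close> \<open>w \<noteq> v\<close> uv w uw dominates_sym by metis
    have xa: "x \<rightarrow>\<^bsub>G\<^esub> a"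
      using two_K2_freeD[OF K2 xw a(2)] two_K2_freeD[OF K2 xw a(3)] not_both
        indD[OF w(1) a(1)] w uw dominates_sym by metis
    have x_I: "b = a \<or> b = w" if "b \<in> I" "x \<rightarrow>\<^bsub>G\<^esub> b" for b
      using three[OF xw xa that(2)] w a that \<open>w \<noteq> a\<close> by blast
    have one: "x \<rightarrow>\<^bsub>G\<^esub> u \<or> x \<rightarrow>\<^bsub>G\<^esub> v"
      using claw_freeD[OF claw, of a u v x] a xa uv x_neq dominates_sym by metis
    have only_a: "b = a"
      if p: "\<not> p \<rightarrow>\<^bsub>G\<^esub> x" "\<not> p \<rightarrow>\<^bsub>G\<^esub> w" and b: "b \<in> I" "p \<rightarrow>\<^bsub>G\<^esub> b" for p b
      using two_K2_freeD[OF K2 b(2) xw] p x_I[OF b(1)] indD[OF b(1) w(1)] b dominates_sym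
      by metis
    show False
    proof (cases "x \<rightarrow>\<^bsub>G\<^esub> u")
      case True
      then have "\<not> x \<rightarrow>\<^bsub>G\<^esub> v"
        using not_both by blast
      with True show False
        using exch[of v u w a x] v uv uw w a xw x_I only_a[of v] dominates_sym by metis
    next
      case False
      with one show False
        using exch[of u v w a x] u uv uw w a xw x_I only_a[of u] dominates_sym by metis
    qed
  qed
  have "u \<rightarrow>\<^bsub>G\<^esub> v" if out: "u \<in> verts G - I" "v \<in> verts G - I" "u \<noteq> v" for u v
  proof (rule ccontr)
    assume uv: "\<not> u \<rightarrow>\<^bsub>G\<^esub> v"
    obtain b where b: "b \<in> I" "u \<rightarrow>\<^bsub>G\<^esub> b" "\<not> v \<rightarrow>\<^bsub>G\<^esub> b"
      using no_nested[of u v] out uv by blast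
    obtain c where c: "c \<in> I" "v \<rightarrow>\<^bsub>G\<^esub> c" "\<not> u \<rightarrow>\<^bsub>G\<^esub> c"
      using no_nested[of v u] out uv by (blast dest: dominates_sym)
    show False
      using two_K2_freeD[OF K2 b(2) c(2)] uv b c indD dominates_sym by metis
  qed
  then have "is_clique G (verts G - I)"
    by (auto simp: is_clique_def)
  with I(1) I_sub show ?thesis
    unfolding split_graph_def by (intro exI[of _ "verts G - I"] exI[of _ I]) auto
qed

end
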